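(* Let $(x_k)_{k\in\mathbb N}\subset\mathbb R^n$ be a sequence, let $x^*$ be an accumulation point of $(x_k)$, and let $L$ be a real-valued function on a set containing $\{x_k:k\in\mathbb N\}$. Suppose that $(L(x_k))$ converges and $|x_{k+1}-x_k|\to0$. If there is an open neighborhood $U$ of $x^*$ such that $$\lim_{\delta\downarrow0}\ \limsup_{\substack{k_1,k_2\to\infty,\ k_1<k_2\\ x_{k_1}\in B(x^*,\delta),\ x_{\llbracket k_1,k_2\rrbracket}\subset U}}\Big(\operatorname{diam}(x_{\llbracket k_1,k_2\rrbracket})+L(x_{k_2})-L(x_{k_1})\Big)\leq0,$$ then $x_k\to x^*$.
   Context: $|\cdot|$ is the Euclidean norm; $B(a,r)$ is the closed ball of center $a$ and radius $r$. For integers $a\le b$, $\llbracket a,b\rrbracket:=\{a,\dots,b\}$ and $x_{\llbracket a,b\rrbracket}:=\{x_a,\dots,x_b\}$. $\operatorname{diam}(A):=\sup_{a,b\in A}|a-b|$. The constrained limsup means $\lim_{N\to\infty}\sup$ of the expression over all pairs $k_2>k_1\ge N$ satisfying the listed constraints. *)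

theory Defs
  imports "HOL-Analysis.Analysis"
begin

text \<open>
  Accumulation points of a sequence are counted by index, so that a value attained
  infinitely often is one.  This is weaker than the range of the sequence having the
  point as a limit point (\<^const>\<open>islimpt\<close>).
\<close>

definition seq_accumulation_point :: "(nat \<Rightarrow> 'a::topological_space) \<Rightarrow> 'a \<Rightarrow> bool" where
  "seq_accumulation_point x a \<longleftrightarrow> (\<forall>V. open V \<and> a \<in> V \<longrightarrow> infinite {k. x k \<in> V})"

text \<open>
  The upper limit of \<open>f k1 k2\<close> as \<open>k1, k2\<close> tend to infinity subject to \<open>k1 < k2\<close> and
  \<open>P k1 k2\<close>.  It is taken in the extended reals, with the supremum over the empty set
  being minus infinity.
\<close>

definition pair_limsup :: "(nat \<Rightarrow> nat \<Rightarrow> bool) \<Rightarrow> (nat \<Rightarrow> nat \<Rightarrow> ereal) \<Rightarrow> ereal" where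
  "pair_limsup P f =
     lim (\<lambda>N. SUP (k1, k2) \<in> {(k1, k2). N \<le> k1 \<and> k1 < k2 \<and> P k1 k2}. f k1 k2)"

text \<open>
  The limit in the definition exists, as does the limit for \<open>\<delta>\<close> decreasing to \<open>0\<close> of upper
  limits whose constraint becomes weaker as \<open>\<delta>\<close> grows, so \<^const>\<open>Lim\<close> is well defined
  in both places.
\<close>

lemma pair_limsup_tendsto:
  "(\<lambda>N. SUP (k1, k2) \<in> {(k1, k2). N \<le> k1 \<and> k1 < k2 \<and> P k1 k2}. f k1 k2)
     \<longlonglongrightarrow> pair_limsup P f"
proof -
  let ?g = "\<lambda>N. SUP (k1, k2) \<in> {(k1, k2). N \<le> k1 \<and> k1 < k2 \<and> P k1 k2}. f k1 k2 :: ereal"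
  have "decseq ?g"
    unfolding decseq_def by (intro allI impI SUP_subset_mono) auto
  then have "?g \<longlonglongrightarrow> (INF N. ?g N)"
    by (rule LIMSEQ_INF)
  then show ?thesis
    unfolding pair_limsup_def by (simp add: limI)
qed

lemma pair_limsup_mono:
  assumes "\<And>k1 k2. P k1 k2 \<Longrightarrow> Q k1 k2"
  shows "pair_limsup P f \<le> pair_limsup Q f"
  by (rule LIMSEQ_le[OF pair_limsup_tendsto pair_limsup_tendsto])
     (use assms in \<open>auto intro!: SUP_subset_mono\<close>)

lemma pair_limsup_tendsto_at_right:
  fixes P :: "real \<Rightarrow> nat \<Rightarrow> nat \<Rightarrow> bool"
  assumes "\<And>d e k1 k2. d \<le> e \<Longrightarrow> P d k1 k2 \<Longrightarrow> P e k1 k2"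
  shows "((\<lambda>\<delta>. pair_limsup (P \<delta>) f) \<longlongrightarrow> Lim (at_right 0) (\<lambda>\<delta>. pair_limsup (P \<delta>) f)) (at_right 0)"
proof -
  let ?h = "\<lambda>\<delta>. pair_limsup (P \<delta>) f"
  have mono: "?h d \<le> ?h e" if "d \<le> e" for d e
    using assms that by (intro pair_limsup_mono) blast
  have "(?h \<longlongrightarrow> (INF \<delta>\<in>{0<..}. ?h \<delta>)) (at_right 0)"
  proof (rule order_tendstoI)
    fix a assume "a < (INF \<delta>\<in>{0<..}. ?h \<delta>)"
    then have "a < ?h \<delta>" if "0 < \<delta>" for \<delta>
      using that by (meson INF_lower greaterThan_iff less_le_trans)
    then show "\<forall>\<^sub>F \<delta> in at_right 0. a < ?h \<delta>"
      by (auto simp: eventually_at_right_field intro: exI[of _ 1])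
  next
    fix a assume "(INF \<delta>\<in>{0<..}. ?h \<delta>) < a"
    then obtain e where "0 < e" "?h e < a"
      by (auto simp: INF_less_iff)
    then show "\<forall>\<^sub>F \<delta> in at_right 0. ?h \<delta> < a"
      unfolding eventually_at_right_field
      by (meson le_less_trans less_imp_le mono)
  qed
  then show ?thesis
    by (metis tendsto_Lim trivial_limit_at_right_real)
qed

end

theory Submission
  imports Defs
begin

text \<open>
  Once the iterates come \<open>\<delta>\<close>-close to \<open>x\<^sup>*\<close> at a late index, they are trapped: while they stay
  in \<open>U\<close>, the descent condition and the convergence of \<open>L (x k)\<close> bound the diameter of the
  piece travelled, so they stay well inside a ball around \<open>x\<^sup>*\<close> contained in \<open>U\<close>, and the
  vanishing step size lets the next iterate not leap out of that ball.
\<close>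

text \<open>The suprema over the tails converge to the upper limit, so one of them is already below
  \<open>c\<close>, and it dominates \<open>f\<close> at every admissible pair of that tail.\<close>

lemma pair_limsup_lessD:
  assumes "pair_limsup P f < c"
  obtains N where "\<And>k1 k2. N \<le> k1 \<Longrightarrow> k1 < k2 \<Longrightarrow> P k1 k2 \<Longrightarrow> f k1 k2 < c"
proof -
  let ?g = "\<lambda>N. SUP (k1, k2) \<in> {(k1, k2). N \<le> k1 \<and> k1 < k2 \<and> P k1 k2}. f k1 k2"
  have "\<forall>\<^sub>F N in sequentially. ?g N < c"
    by (rule order_tendstoD(2)[OF pair_limsup_tendsto assms])
  then obtain N where N: "?g N < c"
    by (auto simp: eventually_sequentially)
  show thesis
  proof
    fix k1 k2 assume "N \<le> k1" "k1 < k2" "P k1 k2"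
    then have "f k1 k2 \<le> ?g N"
      by (intro SUP_upper2[of "(k1, k2)"]) auto
    with N show "f k1 k2 < c" by simp
  qed
qed

lemma seq_accumulation_pointD:
  assumes "seq_accumulation_point x a" "open V" "a \<in> V"
  obtains k where "N \<le> k" "x k \<in> V"
proof -
  have "infinite {k. x k \<in> V}"
    using assms by (auto simp: seq_accumulation_point_def)
  then show thesis
    using that by (auto simp: infinite_nat_iff_unbounded_le)
qed

text \<open>The radius \<open>r\<close> is a budget: \<open>d\<close> for the starting point, one
  \<open>h\<close> for the diameter of the piece travelled, and one \<open>h\<close> for the next
  step, which has to land in the ball before \<open>diam\<close> can be applied to the longer
  piece.\<close>

lemma trapped_in_ball:
  fixes x :: "nat \<Rightarrow> 'a::metric_space"
  assumes start: "dist a (x m) \<le> d"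
    and sum: "d + 2 * h \<le> r" and "0 < h"
    and step: "\<And>k. m \<le> k \<Longrightarrow> dist (x k) (x (Suc k)) < h"
    and diam: "\<And>k. m < k \<Longrightarrow> x ` {m..k} \<subseteq> ball a r \<Longrightarrow> diameter (x ` {m..k}) < h"
    and "m \<le> k"
  shows "dist a (x k) < r"
proof -
  \<comment> \<open>The induction needs this sharper bound: with only \<open>r\<close> in place of
    \<open>d + h\<close>, the next step could leave the ball.\<close>
  have "\<forall>i\<in>{m..k}. dist a (x i) < d + h"
    using \<open>m \<le> k\<close>
  proof (induction k rule: dec_induct)
    case base
    then show ?case using start \<open>0 < h\<close> by simp
  next
    case (step k)
    have "dist a (x (Suc k)) \<le> dist a (x k) + dist (x k) (x (Suc k))"
      by (rule dist_triangle)
    also have "\<dots> < r"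
      using step.IH[rule_format, of k] assms(4)[OF \<open>m \<le> k\<close>] \<open>m \<le> k\<close> sum by simp
    finally have next_in: "dist a (x (Suc k)) < r" .
    have "x ` {m..Suc k} \<subseteq> ball a r"
    proof (intro image_subsetI)
      fix i assume "i \<in> {m..Suc k}"
      then show "x i \<in> ball a r"
        using step.IH[rule_format, of i] next_in sum \<open>0 < h\<close> by (cases "i = Suc k") auto
    qed
    then have "diameter (x ` {m..Suc k}) < h"
      using diam \<open>m \<le> k\<close> by simp
    moreover have "dist (x m) (x (Suc k)) \<le> diameter (x ` {m..Suc k})"
      using \<open>m \<le> k\<close> by (intro diameter_bounded_bound finite_imp_bounded) auto
    \<comment> \<open>Measuring from \<open>x m\<close> instead of \<open>x k\<close> restores the
      invariant, so the step lengths do not add up.\<close>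
    ultimately have "dist a (x (Suc k)) < d + h"
      using start dist_triangle[of a "x (Suc k)" "x m"] by linarith
    then show ?case
      using step.IH by (auto simp: le_Suc_eq)
  qed
  then show ?thesis
    using \<open>m \<le> k\<close> sum \<open>0 < h\<close> by force
qed

theorem theorem2p1:
  fixes x :: "nat \<Rightarrow> real ^ 'n" and xs :: "real ^ 'n"
    and D :: "(real ^ 'n) set" and L :: "real ^ 'n \<Rightarrow> real"
    and U :: "(real ^ 'n) set"
  assumes acc: "seq_accumulation_point x xs"
    and dom: "range x \<subseteq> D"
    and conv: "convergent (\<lambda>k. L (x k))"
    and steps: "(\<lambda>k. norm (x (Suc k) - x k)) \<longlonglongrightarrow> 0"
    and nbhd: "open U" "xs \<in> U"
    and desc: "Lim (at_right (0::real)) (\<lambda>\<delta>.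
        pair_limsup (\<lambda>k1 k2. x k1 \<in> cball xs \<delta> \<and> x ` {k1..k2} \<subseteq> U)
          (\<lambda>k1 k2. ereal (diameter (x ` {k1..k2}) + L (x k2) - L (x k1)))) \<le> 0"
  shows "x \<longlonglongrightarrow> xs"
proof (rule metric_LIMSEQ_I)
  fix e :: real assume "0 < e"
  obtain s where "0 < s" "ball xs s \<subseteq> U"
    using nbhd openE by blast
  \<comment> \<open>The radius serves both the tolerance \<open>e\<close> and the inclusion in
    \<open>U\<close>.\<close>
  define r where "r = min e s"
  have r: "0 < r" "r \<le> e" "ball xs r \<subseteq> U"
    using \<open>0 < e\<close> \<open>0 < s\<close> \<open>ball xs s \<subseteq> U\<close> by (auto simp: r_def)
  define P where "P = (\<lambda>\<delta> k1 k2. x k1 \<in> cball xs \<delta> \<and> x ` {k1..k2} \<subseteq> U)"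
  define f where "f = (\<lambda>k1 k2. diameter (x ` {k1..k2}) + L (x k2) - L (x k1))"
  have "((\<lambda>\<delta>. pair_limsup (P \<delta>) (\<lambda>k1 k2. ereal (f k1 k2))) \<longlongrightarrow>
      Lim (at_right 0) (\<lambda>\<delta>. pair_limsup (P \<delta>) (\<lambda>k1 k2. ereal (f k1 k2)))) (at_right 0)"
    by (rule pair_limsup_tendsto_at_right) (auto simp: P_def)
  \<comment> \<open>The slack \<open>r / 8\<close> here and another \<open>r / 8\<close> for the
    oscillation of \<open>L (x k)\<close> give diameters below \<open>h = r / 4\<close>; with
    \<open>d < r / 2\<close> this yields \<open>d + 2 * h \<le> r\<close>.\<close>
  moreover have "Lim (at_right 0) (\<lambda>\<delta>. pair_limsup (P \<delta>) (\<lambda>k1 k2. ereal (f k1 k2))) < ereal (r / 8)"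
    using desc r(1) unfolding P_def f_def by (rule_tac le_less_trans) auto
  ultimately have "\<forall>\<^sub>F \<delta> in at_right 0. pair_limsup (P \<delta>) (\<lambda>k1 k2. ereal (f k1 k2)) < ereal (r / 8)"
    by (rule order_tendstoD(2))
  moreover have "\<forall>\<^sub>F \<delta> in at_right 0. \<delta> < r / 2"
    using r(1) by (intro order_tendstoD(2)[OF tendsto_ident_at]) simp
  moreover have "\<forall>\<^sub>F \<delta> in at_right (0::real). 0 < \<delta>"
    by (rule eventually_at_right_less)
  ultimately have "\<forall>\<^sub>F \<delta> in at_right 0. pair_limsup (P \<delta>) (\<lambda>k1 k2. ereal (f k1 k2)) < ereal (r / 8)
      \<and> \<delta> < r / 2 \<and> 0 < \<delta>"
    by (intro eventually_conj)
  then obtain d where d: "pair_limsup (P d) (\<lambda>k1 k2. ereal (f k1 k2)) < ereal (r / 8)"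
      "d < r / 2" "0 < d"
    using eventually_happens'[OF trivial_limit_at_right_real] by blast
  obtain N1 where N1: "\<And>k1 k2. N1 \<le> k1 \<Longrightarrow> k1 < k2 \<Longrightarrow> P d k1 k2 \<Longrightarrow> f k1 k2 < r / 8"
    using pair_limsup_lessD[OF d(1)] by auto
  obtain N2 where N2: "\<And>k l. N2 \<le> k \<Longrightarrow> N2 \<le> l \<Longrightarrow> dist (L (x k)) (L (x l)) < r / 8"
    using metric_CauchyD[OF convergent_Cauchy[OF conv], of "r / 8"] r(1) by auto
  obtain N3 where N3: "\<And>k. N3 \<le> k \<Longrightarrow> norm (x (Suc k) - x k) < r / 4"
    using LIMSEQ_D[OF steps, of "r / 4"] r(1) by auto
  \<comment> \<open>Accumulation is counted by index, so a visit to \<open>ball xs d\<close> occurs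
    after all three thresholds.\<close>
  obtain m where m: "max N1 (max N2 N3) \<le> m" "x m \<in> ball xs d"
    using seq_accumulation_pointD[OF acc open_ball] d(3) centre_in_ball by metis
  have diam: "diameter (x ` {m..k}) < r / 4" if "m < k" "x ` {m..k} \<subseteq> ball xs r" for k
  proof -
    have "P d m k"
      using m(2) that(2) r(3) by (auto simp: P_def)
    then have "f m k < r / 8"
      using N1 m(1) that(1) by simp
    moreover have "dist (L (x m)) (L (x k)) < r / 8"
      using N2 m(1) that(1) by simp
    \<comment> \<open>The diameter is \<open>f m k + L (x m) - L (x k)\<close>, a sum of two
      quantities below \<open>r / 8\<close>.\<close>
    ultimately show ?thesis
      unfolding f_def dist_real_def by linarith
  qed
  have "dist xs (x k) < r" if "m \<le> k" for k
  proof (rule trapped_in_ball[where d = d and h = "r / 4" and m = m])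
    show "dist (x i) (x (Suc i)) < r / 4" if "m \<le> i" for i
      using N3[of i] m(1) that by (simp add: dist_norm norm_minus_commute)
  qed (use m(2) d(2) r(1) diam that in auto)
  then show "\<exists>K. \<forall>k\<ge>K. dist (x k) xs < e"
    using r(2) by (metis dist_commute less_le_trans)
qed

end
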